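(* Let $f:\mathbb{R}^n\to\mathbb{R}^n$ and $g:\mathbb{R}^n\to\mathbb{R}^{n\times m}$ be locally Lipschitz, and consider $\dot x=f(x)+g(x)u$ with $u\in\mathcal U=\{u\in\mathbb{R}^m\mid Pu\le q\}$, where $\mathcal U$ is a (bounded) polytope. Let $h:\mathbb{R}^n\to\mathbb{R}$ be continuously differentiable, let $\mathcal C=\{x\in\mathbb{R}^n\mid h(x)\ge 0\}$, and suppose $h$ is a control barrier function for the system with input set $\mathcal U$. Let $\alpha_\vartheta:\mathbb{R}^n\times\mathbb{R}\to\mathbb{R}$ be a function (parameterized by a neural network), and set $$A(x)=\begin{bmatrix}-L_gh(x)\\ P\end{bmatrix},\qquad b_\vartheta(x)=\begin{bmatrix}L_fh(x)+\alpha_\vartheta(x,h(x))\\ q\end{bmatrix},\qquad K_\vartheta(x)=\{u\in\mathbb{R}^m\mid A(x)u\le b_\vartheta(x)\},$$ where $A(x)$ and $b_\vartheta(x)$ are continuous in $x$. Assume that (i) $0$ is a regular value of $h$; (ii) $\alpha_\vartheta(x,h)$ is locally Lipschitz in $h$, with $\alpha_\vartheta(x,0)=0$; (iii) $K_\vartheta(x)$ is nonempty for all $x\in\mathbb{R}^n$. Let the control input be $u=\mathcal P^*(x)$, where $\mathcal P^*$ is the CAffNet-Lite controller (defined in the context) with the state-dependent affine constraints $A(x)u\le b_\vartheta(x)$. Then this controller guarantees strong forward invariance of the safe set $\mathcal C$ in the Filippov sense, i.e. every Filippov solution $x(\cdot)$ of $\dot x=f(x)+g(x)\mathcal P^*(x)$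 with $x(0)\in\mathcal C$ satisfies $h(x(t))\ge 0$ for all $t\ge 0$ in its interval of existence. Thus it solves the safe-by-design control problem: $\mathcal P^*(x)\in\mathcal U$ for all $x$, and $\mathcal C$ is strongly forward invariant.
   Context: Notation: $L_fh(x)=\frac{\partial h}{\partial x}(x)f(x)\in\mathbb{R}$ and $L_gh(x)=\frac{\partial h}{\partial x}(x)g(x)\in\mathbb{R}^{1\times m}$. Vector inequalities are componentwise. $M^\dagger$ is the pseudoinverse of $M$. A continuously differentiable $h$ is a control barrier function (CBF) for the system with input set $\mathcal U$ if there is an extended class-$\mathcal K$ function $\alpha$ (continuous, strictly increasing, $\alpha(0)=0$) such that $\sup_{u\in\mathcal U}[L_fh(x)+L_gh(x)u]\ge-\alpha(h(x))$ for all $x\in\mathcal C$. Safe-by-design control problem: design a neural network controller $u=\pi_\theta(x)\in\mathcal U$ together with a neural network $\alpha_\vartheta(x,h(x))$ replacing $\alpha(h(x))$ in the CBF constraint such that $\mathcal C$ is (strongly) forward invariant. CAffNet-Lite controller. Let $A(x)\in\mathbb{R}^{n_c\times m}$ and $b(x)\in\mathbb{R}^{n_c}$ (here $b=b_\vartheta$), with rows $a_j(x)^\top$ and entries $b_j(x)$, and let $\mathcal S(x)=\{y\in\mathbb{R}^m\mid A(x)y\le b(x)\}$ (here $\mathcal S(x)=K_\vartheta(x)$). Let $\Gamma$ be the set of all index sequences $\gamma=(j_1,\dots,j_k)$ with $k\in\{1,\min(n_c,m)\}$ and $1\le j_1<\dots<j_k\le n_c$. For $\gamma\in\Gamma$,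 let $A_\gamma(x)$ and $b_\gamma(x)$ be the submatrix of $A(x)$ and the subvector of $b(x)$ with rows indexed by $\gamma$ (no rank condition is imposed). Let $f_\theta(x)\in\mathbb{R}^m$ be the output of an unconstrained neural network and $w_\phi(x)\in\mathbb{R}^m$ a learned null-space component (also a neural network), and define $$\mathcal P_\gamma(x)=f_\theta(x)-A_\gamma^\dagger(x)\big(A_\gamma(x)f_\theta(x)-b_\gamma(x)\big)+\big(I-A_\gamma^\dagger(x)A_\gamma(x)\big)w_\phi(x),$$ $$\mathcal S_{\mathcal P}(x)=\{\mathcal P_\gamma(x)\mid \gamma\in\Gamma,\ A(x)\mathcal P_\gamma(x)\le b(x)\}.$$ Fix a $p$-norm $\|\cdot\|_p$ on $\mathbb{R}^m$. The output is $\mathcal P^*(x)=f_\theta(x)$ if $f_\theta(x)\in\mathcal S(x)$, and otherwise $\mathcal P^*(x)$ is an element of $\arg\min_{y\in\mathcal S_{\mathcal P}(x)}\|y-f_\theta(x)\|_p$, with ties broken arbitrarily. Thus $\mathcal P^*$ may be discontinuous in $x$. Filippov solutions. For $X(x)=f(x)+g(x)\mathcal P^*(x)$, the Filippov regularization is $\mathcal F[X](x)=\bigcap_{\delta>0}\bigcap_{\mu(N)=0}\overline{\mathrm{co}}\,X(B(x,\delta)\setminus N)$, where $\mu$ is Lebesgue measure on $\mathbb{R}^n$, $B(x,\delta)$ is the ball of radius $\delta$ about $x$, and $\overline{\mathrm{co}}$ is the closed convex hull. A Filippov solution is an absolutely continuous curve $x(\cdot)$ on an interval with $\dot x(t)\in\mathcal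 F[X](x(t))$ for almost every $t$. *)

theory Defs
  imports "HOL-Analysis.Analysis"
begin

section \<open>Differential notions\<close>

definition locally_lipschitz :: "('a::metric_space \<Rightarrow> 'b::metric_space) \<Rightarrow> bool" where
  "locally_lipschitz f \<longleftrightarrow> (\<forall>x. \<exists>u>0. \<exists>L. L-lipschitz_on (cball x u) f)"

definition continuously_differentiable ::
  "('a::real_normed_vector \<Rightarrow> 'b::real_normed_vector) \<Rightarrow> bool" where
  "continuously_differentiable h \<longleftrightarrow>
     (\<exists>h' :: 'a \<Rightarrow> 'a \<Rightarrow>\<^sub>L 'b.
        (\<forall>x. (h has_derivative blinfun_apply (h' x)) (at x)) \<and> continuous_on UNIV h')"

definition regular_value ::
  "('a::real_normed_vector \<Rightarrow> 'b::real_normed_vector) \<Rightarrow> 'b \<Rightarrow> bool" where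
  "regular_value h c \<longleftrightarrow> (\<forall>x. h x = c \<longrightarrow> surj (frechet_derivative h (at x)))"

text \<open>The row vector of partial derivatives of \<open>h\<close>.\<close>

definition grad :: "(real^'n \<Rightarrow> real) \<Rightarrow> real^'n \<Rightarrow> real^'n" where
  "grad h x = (\<chi> i. frechet_derivative h (at x) (axis i 1))"

definition lie_f :: "(real^'n \<Rightarrow> real^'n) \<Rightarrow> (real^'n \<Rightarrow> real) \<Rightarrow> real^'n \<Rightarrow> real" where
  "lie_f f h x = grad h x \<bullet> f x"

definition lie_g :: "(real^'n \<Rightarrow> real^'m^'n) \<Rightarrow> (real^'n \<Rightarrow> real) \<Rightarrow> real^'n \<Rightarrow> real^'m" where
  "lie_g g h x = grad h x v* g x"


section \<open>Control barrier functions\<close>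

definition extended_class_K :: "(real \<Rightarrow> real) \<Rightarrow> bool" where
  "extended_class_K \<alpha> \<longleftrightarrow> continuous_on UNIV \<alpha> \<and> strict_mono \<alpha> \<and> \<alpha> 0 = 0"

definition safe_set :: "(real^'n \<Rightarrow> real) \<Rightarrow> (real^'n) set" where
  "safe_set h = {x. h x \<ge> 0}"

text \<open>The supremum is taken in \<^typ>\<open>ereal\<close>, so that it is \<open>-\<infinity>\<close> for empty \<open>U\<close>
  and \<open>\<infinity>\<close> in the unbounded case.\<close>

definition control_barrier_function ::
  "(real^'n \<Rightarrow> real^'n) \<Rightarrow> (real^'n \<Rightarrow> real^'m^'n) \<Rightarrow> (real^'m) set \<Rightarrow> (real^'n \<Rightarrow> real) \<Rightarrow> bool"
where
  "control_barrier_function f g U h \<longleftrightarrow>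
     continuously_differentiable h \<and>
     (\<exists>\<alpha>. extended_class_K \<alpha> \<and>
        (\<forall>x\<in>safe_set h.
           (SUP u\<in>U. ereal (lie_f f h x + lie_g g h x \<bullet> u)) \<ge> ereal (- \<alpha> (h x))))"


section \<open>Affine constraints\<close>

text \<open>On vectors, \<open>\<le>\<close> is the componentwise order.\<close>

definition polyhedron_of :: "real^'m^'c \<Rightarrow> real^'c \<Rightarrow> (real^'m) set" where
  "polyhedron_of M d = {u. M *v u \<le> d}"

text \<open>The stacked matrix and vector \<open>[r; M]\<close> and \<open>[s; d]\<close>: the top row has index
  \<^const>\<open>None\<close>.\<close>

definition stack_mat :: "real^'m \<Rightarrow> real^'m^'p \<Rightarrow> real^'m^('p option)" where
  "stack_mat r M = (\<chi> i. case i of None \<Rightarrow> r | Some j \<Rightarrow> M $ j)"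

definition stack_vec :: "real \<Rightarrow> real^'p \<Rightarrow> real^('p option)" where
  "stack_vec s d = (\<chi> i. case i of None \<Rightarrow> s | Some j \<Rightarrow> d $ j)"

definition constraint_mat ::
  "(real^'n \<Rightarrow> real^'m^'n) \<Rightarrow> (real^'n \<Rightarrow> real) \<Rightarrow> real^'m^'p \<Rightarrow> real^'n \<Rightarrow> real^'m^('p option)"
where
  "constraint_mat g h P x = stack_mat (- lie_g g h x) P"

definition constraint_vec ::
  "(real^'n \<Rightarrow> real^'n) \<Rightarrow> (real^'n \<Rightarrow> real) \<Rightarrow> (real^'n \<Rightarrow> real \<Rightarrow> real) \<Rightarrow> real^'p
     \<Rightarrow> real^'n \<Rightarrow> real^('p option)"
where
  "constraint_vec f h \<alpha> q x = stack_vec (lie_f f h x + \<alpha> x (h x)) q"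


section \<open>Pseudoinverse and row submatrices\<close>

text \<open>The Moore--Penrose pseudoinverse, given by the four Penrose equations.\<close>

definition is_pseudoinverse :: "real^'m^'c \<Rightarrow> real^'c^'m \<Rightarrow> bool" where
  "is_pseudoinverse M X \<longleftrightarrow>
     M ** X ** M = M \<and> X ** M ** X = X \<and>
     transpose (M ** X) = M ** X \<and> transpose (X ** M) = X ** M"

definition pseudoinverse :: "real^'m^'c \<Rightarrow> real^'c^'m" where
  "pseudoinverse M = (THE X. is_pseudoinverse M X)"

lemma is_pseudoinverse_unique:
  assumes "is_pseudoinverse M X" "is_pseudoinverse M Y"
  shows "X = Y"
proof -
  have X: "M ** X ** M = M" "X ** M ** X = X" "transpose (M ** X) = M ** X"
      "transpose (X ** M) = X ** M"
    and Y: "M ** Y ** M = M" "Y ** M ** Y = Y" "transpose (M ** Y) = M ** Y"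
      "transpose (Y ** M) = Y ** M"
    using assms by (auto simp: is_pseudoinverse_def)
  have "M ** X = transpose ((M ** Y) ** (M ** X))"
    using X(3) Y(1) by (metis matrix_mul_assoc)
  also have "\<dots> = (M ** X) ** (M ** Y)"
    using X(3) Y(3) by (simp add: matrix_transpose_mul)
  also have "\<dots> = M ** Y"
    using X(1) by (metis matrix_mul_assoc)
  finally have MX: "M ** X = M ** Y" .
  have "X ** M = transpose ((X ** M) ** (Y ** M))"
    using X(4) Y(1) by (metis matrix_mul_assoc)
  also have "\<dots> = (Y ** M) ** (X ** M)"
    using X(4) Y(4) by (simp add: matrix_transpose_mul)
  also have "\<dots> = Y ** M"
    using X(1) by (metis matrix_mul_assoc)
  finally have XM: "X ** M = Y ** M" .
  show ?thesis
    using MX XM X(2) Y(2) by (metis matrix_mul_assoc)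
qed

lemma pseudoinverse_eqI: "is_pseudoinverse M X \<Longrightarrow> pseudoinverse M = X"
  unfolding pseudoinverse_def by (blast intro: is_pseudoinverse_unique)

text \<open>A strictly increasing index sequence \<open>j\<^sub>1 < \<dots> < j\<^sub>k\<close> is identified with the set
  \<open>J\<close> of its entries. Since the number of rows of a matrix is fixed by its type, the submatrix
  with rows in \<open>J\<close> is represented by zeroing the other rows. The pseudoinverse of that matrix
  is the pseudoinverse of the genuine submatrix with zero columns inserted, so the projections
  below are unaffected; this is lemma \<open>pseudoinverse_select_rows\<close>, where
  the genuine submatrix is indexed by \<open>\<gamma>\<close>.\<close>

definition select_rows :: "'c set \<Rightarrow> ('a::zero)^'c \<Rightarrow> 'a^'c" where
  "select_rows J v = (\<chi> i. if i \<in> J then v $ i else 0)"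

lemma pseudoinverse_select_rows:
  fixes A :: "real^'m^'c" and \<gamma> :: "'k::finite \<Rightarrow> 'c" and X :: "real^'k^'m"
  assumes \<gamma>: "inj \<gamma>" and X: "is_pseudoinverse (\<chi> i. A $ \<gamma> i) X"
  shows "pseudoinverse (select_rows (range \<gamma>) A) *v select_rows (range \<gamma>) v = X *v (\<chi> i. v $ \<gamma> i)"
    and "pseudoinverse (select_rows (range \<gamma>) A) ** select_rows (range \<gamma>) A = X ** (\<chi> i. A $ \<gamma> i)"
proof -
  define E :: "real^'k^'c" where "E = (\<chi> i k. if i = \<gamma> k then 1 else 0)"
  define B where "B = (\<chi> i. A $ \<gamma> i)"
  have EE: "transpose E ** E = mat 1"
  proof -
    have "(\<Sum>c\<in>UNIV. (if c = \<gamma> i then 1 else 0) * (if c = \<gamma> j then 1 else 0)) = (if i = j then 1 else (0::real))"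
      for i j
    proof -
      have "(\<Sum>c\<in>UNIV. (if c = \<gamma> i then 1 else 0) * (if c = \<gamma> j then 1 else 0)) =
          (\<Sum>c\<in>UNIV. if c = \<gamma> i then (if i = j then 1 else 0) else (0::real))"
        using \<gamma> by (intro sum.cong) (auto simp: inj_eq)
      then show ?thesis by simp
    qed
    then show ?thesis
      by (simp add: E_def matrix_matrix_mult_def transpose_def mat_def vec_eq_iff)
  qed
  have sum1: "(\<Sum>k\<in>UNIV. (if i = \<gamma> k then 1 else 0) * F (\<gamma> k)) = (if i \<in> range \<gamma> then F i else 0)"
    for i and F :: "'c \<Rightarrow> real"
  proof (cases "i \<in> range \<gamma>")
    case True
    then obtain k where k: "i = \<gamma> k" by auto
    have "(\<Sum>l\<in>UNIV. (if i = \<gamma> l then 1 else 0) * F (\<gamma> l)) = (\<Sum>l\<in>UNIV. if l = k then F i else 0)"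
      using \<gamma> k by (intro sum.cong) (auto simp: inj_eq)
    then show ?thesis using True by simp
  next
    case False
    then show ?thesis by (auto intro!: sum.neutral)
  qed
  have A: "select_rows (range \<gamma>) A = E ** B"
    using sum1[of _ "\<lambda>i. A $ i $ _"]
    by (simp add: vec_eq_iff select_rows_def E_def B_def matrix_matrix_mult_def)
  have v: "select_rows (range \<gamma>) v = E *v (\<chi> i. v $ \<gamma> i)" for v :: "real^'c"
    using sum1[of _ "\<lambda>i. v $ i"]
    by (simp add: vec_eq_iff select_rows_def E_def matrix_vector_mult_def)
  have EE': "transpose E ** (E ** Z) = Z" for Z :: "real^'q^'k"
    by (simp add: matrix_mul_assoc EE)
  have EEl: "Z ** transpose E ** E = Z" for Z :: "real^'k^'q"
    by (simp add: matrix_mul_assoc[symmetric] EE)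
  have X': "B ** X ** B = B" "X ** B ** X = X" "transpose (B ** X) = B ** X"
      "transpose (X ** B) = X ** B"
    using X by (auto simp: is_pseudoinverse_def B_def)
  have "is_pseudoinverse (E ** B) (X ** transpose E)"
    unfolding is_pseudoinverse_def
  proof (intro conjI)
    show "E ** B ** (X ** transpose E) ** (E ** B) = E ** B"
      using X'(1) by (metis matrix_mul_assoc EE')
    show "X ** transpose E ** (E ** B) ** (X ** transpose E) = X ** transpose E"
      using X'(2) by (metis matrix_mul_assoc EE')
    have "E ** B ** (X ** transpose E) = E ** (B ** X) ** transpose E"
      by (simp add: matrix_mul_assoc)
    then show "transpose (E ** B ** (X ** transpose E)) = E ** B ** (X ** transpose E)"
      using X'(3) by (simp add: matrix_transpose_mul matrix_mul_assoc)
    show "transpose (X ** transpose E ** (E ** B)) = X ** transpose E ** (E ** B)"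
      using X'(4) by (simp add: EE' matrix_mul_assoc[symmetric])
  qed
  then have P: "pseudoinverse (select_rows (range \<gamma>) A) = X ** transpose E"
    unfolding A by (rule pseudoinverse_eqI)
  show "pseudoinverse (select_rows (range \<gamma>) A) *v select_rows (range \<gamma>) v = X *v (\<chi> i. v $ \<gamma> i)"
    unfolding P v by (simp add: matrix_vector_mul_assoc EEl)
  show "pseudoinverse (select_rows (range \<gamma>) A) ** select_rows (range \<gamma>) A = X ** (\<chi> i. A $ \<gamma> i)"
    unfolding P unfolding A by (simp add: matrix_mul_assoc EEl B_def)
qed


section \<open>The CAffNet-Lite controller\<close>

definition index_sets :: "'m::finite itself \<Rightarrow> ('c::finite) set set" where
  "index_sets _ = {J. card J \<in> {1, min CARD('c) CARD('m)}}"

text \<open>In this section \<open>A\<close>, \<open>b\<close>, \<open>y0\<close>, \<open>w\<close> are the values at a state \<open>x\<close> of the constraint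
  matrix, the constraint vector, the unconstrained network \<open>f\<^sub>\<theta>\<close> and the null-space
  network \<open>w\<^sub>\<phi>\<close>.\<close>

definition affine_proj ::
  "real^'m^'c \<Rightarrow> real^'c \<Rightarrow> real^'m \<Rightarrow> real^'m \<Rightarrow> 'c set \<Rightarrow> real^'m"
where
  "affine_proj A b y0 w J =
     (let AJ = select_rows J A; bJ = select_rows J b in
        y0 - pseudoinverse AJ *v (AJ *v y0 - bJ) + (mat 1 - pseudoinverse AJ ** AJ) *v w)"

definition candidates ::
  "real^'m^'c \<Rightarrow> real^'c \<Rightarrow> real^'m \<Rightarrow> real^'m \<Rightarrow> (real^'m) set"
where
  "candidates A b y0 w =
     {affine_proj A b y0 w J | J. J \<in> index_sets TYPE('m) \<and> A *v affine_proj A b y0 w J \<le> b}"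

text \<open>The \<open>p\<close>-norm for \<open>1 \<le> p \<le> \<infinity>\<close>.\<close>

definition pnorm :: "ereal \<Rightarrow> real^'m \<Rightarrow> real" where
  "pnorm p v =
     (if p = \<infinity> then infnorm v
      else (\<Sum>i\<in>UNIV. \<bar>v $ i\<bar> powr real_of_ereal p) powr (1 / real_of_ereal p))"

definition caffnet_lite_output ::
  "ereal \<Rightarrow> real^'m^'c \<Rightarrow> real^'c \<Rightarrow> real^'m \<Rightarrow> real^'m \<Rightarrow> real^'m \<Rightarrow> bool"
where
  "caffnet_lite_output p A b y0 w y \<longleftrightarrow>
     (if y0 \<in> polyhedron_of A b then y = y0
      else is_arg_min (\<lambda>z. pnorm p (z - y0)) (\<lambda>z. z \<in> candidates A b y0 w) y)"

text \<open>Being a relation, this covers every way of breaking ties, including discontinuous ones.\<close>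

definition caffnet_lite_controller ::
  "ereal \<Rightarrow> (real^'n \<Rightarrow> real^'m^'c) \<Rightarrow> (real^'n \<Rightarrow> real^'c) \<Rightarrow> (real^'n \<Rightarrow> real^'m)
     \<Rightarrow> (real^'n \<Rightarrow> real^'m) \<Rightarrow> (real^'n \<Rightarrow> real^'m) \<Rightarrow> bool"
where
  "caffnet_lite_controller p A b f\<^sub>\<theta> w\<^sub>\<phi> \<pi> \<longleftrightarrow>
     (\<forall>x. caffnet_lite_output p (A x) (b x) (f\<^sub>\<theta> x) (w\<^sub>\<phi> x) (\<pi> x))"


section \<open>Filippov solutions and invariance\<close>

definition filippov :: "('a::euclidean_space \<Rightarrow> 'a) \<Rightarrow> 'a \<Rightarrow> 'a set" where
  "filippov X x = (\<Inter>\<delta>\<in>{0<..}. \<Inter>N\<in>null_sets lebesgue. closure (convex hull (X ` (ball x \<delta> - N))))"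

definition absolutely_continuous_on :: "real set \<Rightarrow> (real \<Rightarrow> 'a::real_normed_vector) \<Rightarrow> bool" where
  "absolutely_continuous_on S x \<longleftrightarrow>
     (\<forall>\<epsilon>>0. \<exists>\<delta>>0. \<forall>(n::nat) a b.
        (\<forall>i<n. a i \<le> b i \<and> {a i..b i} \<subseteq> S) \<and>
        disjoint_family_on (\<lambda>i. {a i<..<b i}) {..<n} \<and>
        (\<Sum>i<n. b i - a i) < \<delta> \<longrightarrow>
        (\<Sum>i<n. norm (x (b i) - x (a i))) < \<epsilon>)"

text \<open>Absolute continuity is required on compact subintervals of the interval of existence, which
  may be unbounded or not closed.\<close>

definition filippov_solution ::
  "('a::euclidean_space \<Rightarrow> 'a) \<Rightarrow> real set \<Rightarrow> (real \<Rightarrow> 'a) \<Rightarrow> bool"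
where
  "filippov_solution X I x \<longleftrightarrow>
     is_interval I \<and>
     (\<forall>c d. {c..d} \<subseteq> I \<longrightarrow> absolutely_continuous_on {c..d} x) \<and>
     (AE t in lebesgue. t \<in> I \<longrightarrow>
        (\<exists>v\<in>filippov X (x t). (x has_vector_derivative v) (at t within I)))"

definition strongly_forward_invariant :: "('a::euclidean_space \<Rightarrow> 'a) \<Rightarrow> 'a set \<Rightarrow> bool" where
  "strongly_forward_invariant X C \<longleftrightarrow>
     (\<forall>I x. filippov_solution X I x \<and> 0 \<in> I \<and> x 0 \<in> C \<longrightarrow> (\<forall>t\<in>I. t \<ge> 0 \<longrightarrow> x t \<in> C))"

end

theory Submission
  imports Defs
begin

text \<open>Since the output of the controller is feasible, \<open>X = f + g \<pi>\<close> satisfies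
  \<open>\<nabla>h(x) \<bullet> X(x) \<ge> - \<alpha>(x, h(x))\<close> at every point. Both \<open>\<nabla>h\<close> and the right-hand side are
  continuous and \<open>X\<close> is locally bounded, so the inequality passes to all elements of the
  Filippov regularization, however discontinuous \<open>\<pi>\<close> is. Along a Filippov solution \<open>h\<close> thus obeys
  a scalar differential inequality almost everywhere, and the Lipschitz bound
  \<open>\<alpha>(x, r) \<le> L \<bar>r\<bar>\<close> prevents it from becoming negative.\<close>

section \<open>Absolutely continuous functions\<close>

lemma absolutely_continuous_on_subset:
  assumes "absolutely_continuous_on S x" "T \<subseteq> S"
  shows "absolutely_continuous_on T x"
  unfolding absolutely_continuous_on_def
proof (intro allI impI)
  fix \<epsilon> :: real assume "\<epsilon> > 0"
  then obtain \<delta> where \<delta>: "\<delta> > 0"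
    "\<And>(n::nat) a b. (\<forall>i<n. a i \<le> b i \<and> {a i..b i} \<subseteq> S) \<and>
        disjoint_family_on (\<lambda>i. {a i<..<b i}) {..<n} \<and> (\<Sum>i<n. b i - a i) < \<delta> \<longrightarrow>
        (\<Sum>i<n. norm (x (b i) - x (a i))) < \<epsilon>"
    using assms(1) unfolding absolutely_continuous_on_def by blast
  show "\<exists>\<delta>>0. \<forall>(n::nat) a b. (\<forall>i<n. a i \<le> b i \<and> {a i..b i} \<subseteq> T) \<and>
        disjoint_family_on (\<lambda>i. {a i<..<b i}) {..<n} \<and> (\<Sum>i<n. b i - a i) < \<delta> \<longrightarrow>
        (\<Sum>i<n. norm (x (b i) - x (a i))) < \<epsilon>"
  proof (intro exI[of _ \<delta>] conjI allI impI; (elim conjE)?)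
    fix n :: nat and a b
    assume ab: "\<forall>i<n. a i \<le> b i \<and> {a i..b i} \<subseteq> T" "disjoint_family_on (\<lambda>i. {a i<..<b i}) {..<n}"
      "(\<Sum>i<n. b i - a i) < \<delta>"
    have "a i \<le> b i \<and> {a i..b i} \<subseteq> S" if "i < n" for i
      using ab(1)[rule_format, OF that] assms(2) by (meson subset_trans)
    then show "(\<Sum>i<n. norm (x (b i) - x (a i))) < \<epsilon>"
      using \<delta>(2)[of n a b] ab(2,3) by simp
  qed (rule \<delta>(1))
qed

text \<open>A bijection with \<open>{..<card J}\<close> frees the definition from families numbered
  by naturals. Below, a single interval is indexed by \<open>unit\<close>, and the members of a
  tagged division index themselves.\<close>

lemma absolutely_continuous_onE:
  fixes x :: "real \<Rightarrow> 'a::real_normed_vector"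
  assumes "absolutely_continuous_on S x" "\<epsilon> > 0"
  obtains \<delta> where "\<delta> > 0"
    "\<And>J (a :: 'i \<Rightarrow> real) b. finite J \<Longrightarrow> (\<And>i. i \<in> J \<Longrightarrow> a i \<le> b i \<and> {a i..b i} \<subseteq> S) \<Longrightarrow>
       disjoint_family_on (\<lambda>i. {a i<..<b i}) J \<Longrightarrow> (\<Sum>i\<in>J. b i - a i) < \<delta> \<Longrightarrow>
       (\<Sum>i\<in>J. norm (x (b i) - x (a i))) < \<epsilon>"
proof -
  obtain \<delta> where \<delta>: "\<delta> > 0"
    "\<And>(n::nat) a b. (\<forall>i<n. a i \<le> b i \<and> {a i..b i} \<subseteq> S) \<and>
        disjoint_family_on (\<lambda>i. {a i<..<b i}) {..<n} \<and> (\<Sum>i<n. b i - a i) < \<delta> \<longrightarrow>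
        (\<Sum>i<n. norm (x (b i) - x (a i))) < \<epsilon>"
    using assms unfolding absolutely_continuous_on_def by blast
  show thesis
  proof (rule that[OF \<delta>(1)])
    fix J and a b :: "'i \<Rightarrow> real"
    assume J: "finite J" "\<And>i. i \<in> J \<Longrightarrow> a i \<le> b i \<and> {a i..b i} \<subseteq> S"
      "disjoint_family_on (\<lambda>i. {a i<..<b i}) J" "(\<Sum>i\<in>J. b i - a i) < \<delta>"
    obtain e where e: "bij_betw e {..<card J} J"
      using ex_bij_betw_nat_finite[OF J(1)] by (auto simp: atLeast0LessThan)
    have sum: "(\<Sum>i<card J. k (e i)) = (\<Sum>i\<in>J. k i)" for k :: "'i \<Rightarrow> real"
      using sum.reindex_bij_betw[OF e] by simp
    have "disjoint_family_on (\<lambda>i. {a (e i)<..<b (e i)}) {..<card J}"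
      unfolding disjoint_family_on_def
    proof (intro ballI impI)
      fix i j assume ij: "i \<in> {..<card J}" "j \<in> {..<card J}" "i \<noteq> j"
      then have "e i \<noteq> e j" "e i \<in> J" "e j \<in> J"
        using e by (auto simp: bij_betw_def inj_on_def)
      then show "{a (e i)<..<b (e i)} \<inter> {a (e j)<..<b (e j)} = {}"
        using disjoint_family_onD[OF J(3)] by blast
    qed
    moreover have "\<forall>i<card J. a (e i) \<le> b (e i) \<and> {a (e i)..b (e i)} \<subseteq> S"
      using J(2) e by (auto simp: bij_betw_def)
    ultimately show "(\<Sum>i\<in>J. norm (x (b i) - x (a i))) < \<epsilon>"
      using \<delta>(2)[of "card J" "a \<circ> e" "b \<circ> e"] J(4)
        sum[of "\<lambda>i. b i - a i"] sum[of "\<lambda>i. norm (x (b i) - x (a i))"]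
      by simp
  qed
qed

lemma absolutely_continuous_on_imp_continuous_on:
  assumes "absolutely_continuous_on {c..d} x"
  shows "continuous_on {c..d} x"
  unfolding continuous_on_iff
proof (intro ballI allI impI)
  fix t and \<epsilon> :: real assume t: "t \<in> {c..d}" and "\<epsilon> > 0"
  obtain \<delta> where \<delta>: "\<delta> > 0"
    "\<And>J (a :: unit \<Rightarrow> real) b. finite J \<Longrightarrow> (\<And>i. i \<in> J \<Longrightarrow> a i \<le> b i \<and> {a i..b i} \<subseteq> {c..d}) \<Longrightarrow>
       disjoint_family_on (\<lambda>i. {a i<..<b i}) J \<Longrightarrow> (\<Sum>i\<in>J. b i - a i) < \<delta> \<Longrightarrow>
       (\<Sum>i\<in>J. norm (x (b i) - x (a i))) < \<epsilon>"
    by (rule absolutely_continuous_onE[OF assms \<open>\<epsilon> > 0\<close>, where ?'i = unit]) blast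
  have small: "norm (x v - x u) < \<epsilon>" if "u \<le> v" "{u..v} \<subseteq> {c..d}" "v - u < \<delta>" for u v
    using \<delta>(2)[of UNIV "\<lambda>_. u" "\<lambda>_. v"] that by (simp add: disjoint_family_on_def)
  have "dist (x s) (x t) < \<epsilon>" if "s \<in> {c..d}" "dist s t < \<delta>" for s
    using small[of s t] small[of t s] that t
    by (cases "s \<le> t") (auto simp: dist_norm norm_minus_commute)
  then show "\<exists>\<delta>>0. \<forall>s\<in>{c..d}. dist s t < \<delta> \<longrightarrow> dist (x s) (x t) < \<epsilon>"
    using \<delta>(1) by blast
qed

lemma absolutely_continuous_on_lipschitz_compose:
  assumes x: "absolutely_continuous_on S x" and k: "K-lipschitz_on (x ` S) k"
  shows "absolutely_continuous_on S (\<lambda>t. k (x t))"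
  unfolding absolutely_continuous_on_def
proof (intro allI impI)
  fix \<epsilon> :: real assume "\<epsilon> > 0"
  have K: "K \<ge> 0" using k by (rule lipschitz_on_nonneg)
  \<comment> \<open>The Lipschitz constant may be \<open>0\<close>, hence the division by
    \<open>K + 1\<close>.\<close>
  have "\<epsilon> / (K + 1) > 0" using \<open>\<epsilon> > 0\<close> K by simp
  then obtain \<delta> where \<delta>: "\<delta> > 0"
    "\<And>(n::nat) a b. (\<forall>i<n. a i \<le> b i \<and> {a i..b i} \<subseteq> S) \<and>
        disjoint_family_on (\<lambda>i. {a i<..<b i}) {..<n} \<and> (\<Sum>i<n. b i - a i) < \<delta> \<longrightarrow>
        (\<Sum>i<n. norm (x (b i) - x (a i))) < \<epsilon> / (K + 1)"
    using x unfolding absolutely_continuous_on_def by blast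
  have "(\<Sum>i<n. norm (k (x (b i)) - k (x (a i)))) < \<epsilon>"
    if ab: "\<forall>i<n. a i \<le> b i \<and> {a i..b i} \<subseteq> S" "disjoint_family_on (\<lambda>i. {a i<..<b i}) {..<n}"
      "(\<Sum>i<n. b i - a i) < \<delta>" for n :: nat and a b
  proof -
    have "(\<Sum>i<n. norm (k (x (b i)) - k (x (a i)))) \<le> (\<Sum>i<n. K * norm (x (b i) - x (a i)))"
    proof (rule sum_mono)
      fix i assume "i \<in> {..<n}"
      then have "a i \<in> S" "b i \<in> S" using ab(1) by fastforce+
      then show "norm (k (x (b i)) - k (x (a i))) \<le> K * norm (x (b i) - x (a i))"
        using lipschitz_onD[OF k, of "x (b i)" "x (a i)"] by (simp add: dist_norm)
    qed
    also have "\<dots> \<le> (K + 1) * (\<Sum>i<n. norm (x (b i) - x (a i)))"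
      unfolding sum_distrib_left by (intro sum_mono mult_right_mono) auto
    also have "\<dots> < (K + 1) * (\<epsilon> / (K + 1))"
      using \<delta>(2) ab K by (intro mult_strict_left_mono) auto
    finally show ?thesis using K by simp
  qed
  then show "\<exists>\<delta>>0. \<forall>(n::nat) a b.
        (\<forall>i<n. a i \<le> b i \<and> {a i..b i} \<subseteq> S) \<and>
        disjoint_family_on (\<lambda>i. {a i<..<b i}) {..<n} \<and> (\<Sum>i<n. b i - a i) < \<delta> \<longrightarrow>
        (\<Sum>i<n. norm (k (x (b i)) - k (x (a i)))) < \<epsilon>"
    using \<delta>(1) by blast
qed

text \<open>On a tagged division fine enough, intervals tagged in the exceptional null set have small
  total length and so contribute little by absolute continuity, while every other interval
  contributes at least almost \<open>c\<close> times its length.\<close>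

lemma absolutely_continuous_on_derivative_ge:
  fixes F :: "real \<Rightarrow> real"
  assumes "a \<le> b" and ac: "absolutely_continuous_on {a..b} F"
    and der: "AE t in lebesgue. t \<in> {a..b} \<longrightarrow>
      (\<exists>v\<ge>c. (F has_vector_derivative v) (at t within {a..b}))"
  shows "c * (b - a) \<le> F b - F a"
proof -
  \<comment> \<open>The slack collects three errors: \<open>\<epsilon> * (b - a)\<close> from
    difference quotients at good tags, \<open>\<epsilon>\<close> from the increments over bad
    intervals, and \<open>\<bar>c\<bar> * \<epsilon>\<close> from the length that the bad intervals
    take away.\<close>
  have main: "c * (b - a) \<le> F b - F a + \<epsilon> * (b - a + 1 + \<bar>c\<bar>)" if \<epsilon>: "\<epsilon> > 0" for \<epsilon>
  proof -
    obtain N where N: "N \<in> null_sets lebesgue"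
      "\<And>t. t \<in> {a..b} \<Longrightarrow> t \<notin> N \<Longrightarrow> \<exists>v\<ge>c. (F has_vector_derivative v) (at t within {a..b})"
      using AE_E3[OF der] by (metis DiffI UNIV_I space_borel space_completion space_lborel)
    obtain \<delta> where \<delta>: "\<delta> > 0"
      "\<And>J (l :: real \<times> real set \<Rightarrow> real) r. finite J \<Longrightarrow>
         (\<And>i. i \<in> J \<Longrightarrow> l i \<le> r i \<and> {l i..r i} \<subseteq> {a..b}) \<Longrightarrow>
         disjoint_family_on (\<lambda>i. {l i<..<r i}) J \<Longrightarrow> (\<Sum>i\<in>J. r i - l i) < \<delta> \<Longrightarrow>
         (\<Sum>i\<in>J. norm (F (r i) - F (l i))) < \<epsilon>"
      by (rule absolutely_continuous_onE[OF ac \<epsilon>, where ?'i = "real \<times> real set"]) blast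
    \<comment> \<open>Below \<delta>, the length of the bad intervals makes their increments small;
      below \<epsilon>, it makes the lost length small.\<close>
    have "min \<delta> \<epsilon> > 0" using \<delta> \<epsilon> by simp
    moreover have "N \<in> sets lebesgue" using N(1) by blast
    ultimately obtain T where T: "open T" "N \<subseteq> T" "T - N \<in> lmeasurable"
      "emeasure lebesgue (T - N) < ennreal (min \<delta> \<epsilon>)"
      using sets_lebesgue_outer_open by metis
    have Teq: "T = (T - N) \<union> N" using T(2) by auto
    have emT: "emeasure lebesgue T < ennreal (min \<delta> \<epsilon>)"
      using T(3,4) N(1) emeasure_Un_null_set[of "T - N" lebesgue N] Teq by (simp add: fmeasurableD)
    then have Tm: "T \<in> lmeasurable"
      using T(1) by (intro fmeasurableI) (auto intro: order_less_trans)
    have mT: "measure lebesgue T < min \<delta> \<epsilon>"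
      using emT \<open>min \<delta> \<epsilon> > 0\<close> Tm by (simp add: emeasure_eq_measure2 ennreal_less_iff)
    \<comment> \<open>This is the radius of the gauge: at a point of \<open>N\<close> it keeps the
      interval inside the small open set \<open>T\<close>, and at a good point it yields the
      estimate for every interval that contains the tag.\<close>
    have "\<exists>d>0. (t \<in> N \<longrightarrow> ball t d \<subseteq> T) \<and>
        (t \<in> {a..b} - N \<longrightarrow> (\<forall>u v. u \<le> t \<longrightarrow> t \<le> v \<longrightarrow> {u..v} \<subseteq> {a..b} \<inter> ball t d \<longrightarrow>
            (c - \<epsilon>) * (v - u) \<le> F v - F u))" for t
    proof -
      consider "t \<in> N" | "t \<in> {a..b} - N" | "t \<notin> {a..b}" "t \<notin> N" by blast
      then show ?thesis
      proof cases
        case 1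
        then show ?thesis using T(1,2) open_contains_ball by (metis DiffD2 subsetD)
      next
        case 2
        then obtain w where w: "w \<ge> c" "(F has_vector_derivative w) (at t within {a..b})"
          using N(2) by blast
        then obtain d where d: "d > 0"
          "\<And>y. y \<in> {a..b} \<Longrightarrow> norm (y - t) < d \<Longrightarrow>
            norm (F y - F t - (y - t) *\<^sub>R w) \<le> \<epsilon> * norm (y - t)"
          unfolding has_vector_derivative_def has_derivative_within_alt using \<epsilon> by metis
        have "(c - \<epsilon>) * (v - u) \<le> F v - F u"
          if "u \<le> t" "t \<le> v" "{u..v} \<subseteq> {a..b} \<inter> ball t d" for u v
        proof -
          have "u \<in> {u..v}" "v \<in> {u..v}" using that by auto
          then have uv: "u \<in> {a..b} \<inter> ball t d" "v \<in> {a..b} \<inter> ball t d" using that(3) by blast+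
          have "norm (F u - F t - (u - t) *\<^sub>R w) \<le> \<epsilon> * norm (u - t)"
            "norm (F v - F t - (v - t) *\<^sub>R w) \<le> \<epsilon> * norm (v - t)"
            using d(2)[of u] d(2)[of v] uv by (auto simp: dist_real_def)
          \<comment> \<open>Because the tag lies between \<open>u\<close> and \<open>v\<close>, the
            two one-sided errors add up to exactly \<open>\<epsilon> * (v - u)\<close>.\<close>
          then have "w * (v - u) - \<epsilon> * (v - u) \<le> F v - F u"
            using that(1,2) by (auto simp: algebra_simps)
          moreover have "c * (v - u) \<le> w * (v - u)"
            using w(1) that by (intro mult_right_mono) auto
          ultimately show ?thesis by (simp add: algebra_simps)
        qed
        then show ?thesis using d(1) 2 by blast
      next
        case 3
        then show ?thesis by (intro exI[of _ 1]) auto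
      qed
    qed
    then obtain d where d: "\<And>t. d t > 0" "\<And>t. t \<in> N \<Longrightarrow> ball t (d t) \<subseteq> T"
      "\<And>t u v. t \<in> {a..b} - N \<Longrightarrow> u \<le> t \<Longrightarrow> t \<le> v \<Longrightarrow> {u..v} \<subseteq> {a..b} \<inter> ball t (d t) \<Longrightarrow>
         (c - \<epsilon>) * (v - u) \<le> F v - F u"
      by metis
    have "gauge (\<lambda>t. ball t (d t))" using d(1) by (simp add: gauge_def)
    then obtain D where D: "D tagged_division_of {a..b}" "(\<lambda>t. ball t (d t)) fine D"
      by (rule fine_division_exists_real)
    note Dp = tagged_division_ofD[OF D(1)]
    have DK: "Inf K \<le> t \<and> t \<le> Sup K \<and> K = {Inf K..Sup K} \<and> K \<subseteq> {a..b} \<and> K \<subseteq> ball t (d t)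
        \<and> interior K = {Inf K<..<Sup K}"
      if tK: "(t, K) \<in> D" for t K
    proof -
      obtain l r where lr: "K = {l..r}" using Dp(4)[OF tK] by auto
      moreover have "t \<in> K" using Dp(2)[OF tK] .
      ultimately have "Inf K = l" "Sup K = r" by auto
      then show ?thesis
        using lr \<open>t \<in> K\<close> Dp(3)[OF tK] fineD[OF D(2) tK] by auto
    qed
    define l r where "l = (\<lambda>i :: real \<times> real set. Inf (snd i))"
      and "r = (\<lambda>i :: real \<times> real set. Sup (snd i))"
    define G where "G = (\<lambda>i. F (r i) - F (l i))"
    define J where "J = {i \<in> D. fst i \<in> N}"
    have fin: "finite D" "finite J" and JD: "J \<subseteq> D" using Dp(1) by (auto simp: J_def)
    have lr: "l i \<le> r i" "{l i..r i} \<subseteq> {a..b}" "interior (snd i) = {l i<..<r i}" if "i \<in> D" for i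
      using DK[of "fst i" "snd i"] that unfolding l_def r_def by auto
    have disj: "disjoint_family_on (\<lambda>i. {l i<..<r i}) J"
      unfolding disjoint_family_on_def
    proof (intro ballI impI)
      fix i j assume "i \<in> J" "j \<in> J" "i \<noteq> j"
      then show "{l i<..<r i} \<inter> {l j<..<r j} = {}"
        using Dp(5)[of "fst i" "snd i" "fst j" "snd j"] lr(3)[of i] lr(3)[of j] JD by auto
    qed
    \<comment> \<open>Disjointness of the interiors turns the total bad length into the measure of a
      single subset of \<open>T\<close>.\<close>
    have "(\<Sum>i\<in>J. r i - l i) = (\<Sum>i\<in>J. measure lebesgue {l i<..<r i})"
      using lr(1) JD by (intro sum.cong) auto
    also have "\<dots> = measure lebesgue (\<Union>i\<in>J. {l i<..<r i})"
      by (rule measure_finite_Union[symmetric]) (use fin disj in \<open>auto simp: lr JD[THEN subsetD]\<close>)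
    also have "\<dots> \<le> measure lebesgue T"
    proof (rule measure_mono_fmeasurable)
      show "(\<Union>i\<in>J. {l i<..<r i}) \<subseteq> T"
      proof (intro UN_least)
        fix i assume "i \<in> J"
        then have "snd i \<subseteq> ball (fst i) (d (fst i))" "snd i = {l i..r i}" "fst i \<in> N"
          using DK[of "fst i" "snd i"] unfolding J_def l_def r_def by auto
        then show "{l i<..<r i} \<subseteq> T" using d(2)[of "fst i"] by fastforce
      qed
      have "open (\<Union>i\<in>J. {l i<..<r i})" by auto
      then show "(\<Union>i\<in>J. {l i<..<r i}) \<in> sets lebesgue" by (intro sets_completionI_sets) simp
    qed (use Tm in auto)
    finally have Jlen: "(\<Sum>i\<in>J. r i - l i) < min \<delta> \<epsilon>" using mT by simp
    have "(\<Sum>i\<in>J. norm (G i)) < \<epsilon>"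
      unfolding G_def using lr JD Jlen by (intro \<delta>(2)[OF fin(2) _ disj]) auto
    moreover have "(\<Sum>i\<in>J. - norm (G i)) \<le> (\<Sum>i\<in>J. G i)"
      by (intro sum_mono) auto
    ultimately have bad: "- \<epsilon> \<le> (\<Sum>i\<in>J. G i)" by (simp add: sum_negf)
    have "(c - \<epsilon>) * (r i - l i) \<le> G i" if "i \<in> D - J" for i
    proof -
      have iD: "(fst i, snd i) \<in> D" using that by simp
      from DK[OF iD] have "fst i \<in> {a..b}" by (metis atLeastAtMost_iff subsetD)
      then show ?thesis
        unfolding G_def using DK[OF iD] that by (intro d(3)[of "fst i"]) (auto simp: J_def l_def r_def)
    qed
    then have good: "(c - \<epsilon>) * (\<Sum>i\<in>D-J. r i - l i) \<le> (\<Sum>i\<in>D-J. G i)"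
      unfolding sum_distrib_left by (intro sum_mono) auto
    have tot: "(\<Sum>i\<in>D. r i - l i) = b - a"
      using additive_tagged_division_1[OF assms(1) D(1), of "\<lambda>t. t"]
      by (simp add: l_def r_def case_prod_beta)
    have "(\<Sum>i\<in>D. G i) = F b - F a"
      using additive_tagged_division_1[OF assms(1) D(1), of F]
      by (simp add: G_def l_def r_def case_prod_beta)
    then have "F b - F a = (\<Sum>i\<in>D-J. G i) + (\<Sum>i\<in>J. G i)"
      using sum.subset_diff[OF JD fin(1), of G] by simp
    moreover have "(\<Sum>i\<in>D-J. r i - l i) = (b - a) - (\<Sum>i\<in>J. r i - l i)"
      using sum.subset_diff[OF JD fin(1), of "\<lambda>i. r i - l i"] tot by simp
    moreover define s where "s = (\<Sum>i\<in>J. r i - l i)"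
    ultimately have low: "(c - \<epsilon>) * ((b - a) - s) - \<epsilon> \<le> F b - F a"
      using good bad by simp
    have s: "0 \<le> s" "s < \<epsilon>"
      using Jlen lr(1) JD unfolding s_def by (auto intro!: sum_nonneg)
    \<comment> \<open>The sign of \<open>c\<close> is unknown, hence the absolute value.\<close>
    have "c * s \<le> \<bar>c\<bar> * \<epsilon>" using s by (intro mult_mono) auto
    moreover have "0 \<le> \<epsilon> * s" using s \<epsilon> by simp
    ultimately show ?thesis using low by (simp add: algebra_simps)
  qed
  show ?thesis
  proof (rule field_le_epsilon)
    fix e :: real assume "e > 0"
    have pos: "b - a + 1 + \<bar>c\<bar> > 0" using assms(1) by linarith
    then show "c * (b - a) \<le> F b - F a + e"
      using main[of "e / (b - a + 1 + \<bar>c\<bar>)"] \<open>e > 0\<close> by simp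
  qed
qed

section \<open>Vertices of bounded polyhedra and feasibility of the candidates\<close>

lemma closed_polyhedron_of: "closed (polyhedron_of M d)"
proof -
  have "polyhedron_of M d = (\<Inter>i. {u. M $ i \<bullet> u \<le> d $ i})"
    by (auto simp: polyhedron_of_def less_eq_vec_def matrix_vector_mul_component)
  then show ?thesis by (auto intro!: closed_INT closed_halfspace_le)
qed

lemma convex_polyhedron_of: "convex (polyhedron_of M d)"
proof -
  have "polyhedron_of M d = (\<Inter>i. {u. M $ i \<bullet> u \<le> d $ i})"
    by (auto simp: polyhedron_of_def less_eq_vec_def matrix_vector_mul_component)
  then show ?thesis by (auto intro!: convex_INT convex_halfspace_le)
qed

text \<open>Otherwise some nonzero \<open>w\<close> is orthogonal to all active rows. Small steps
  along \<open>w\<close> and \<open>- w\<close> leave the active constraints tight and the others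
  slack, so \<open>v\<close> would be the midpoint of a segment inside the polyhedron.\<close>

lemma extreme_point_active_rows_span:
  fixes M :: "real^'m^'c"
  assumes v: "v extreme_point_of polyhedron_of M d"
  shows "span ((\<lambda>i. M $ i) ` {i. M $ i \<bullet> v = d $ i}) = UNIV"
proof (rule ccontr)
  define J where "J = {i. M $ i \<bullet> v = d $ i}"
  assume "span ((\<lambda>i. M $ i) ` {i. M $ i \<bullet> v = d $ i}) \<noteq> UNIV"
  then obtain w where w: "w \<noteq> 0" "\<And>y. y \<in> span ((\<lambda>i. M $ i) ` J) \<Longrightarrow> w \<bullet> y = 0"
    unfolding J_def using span_not_UNIV_orthogonal by blast
  have vP: "M $ i \<bullet> v \<le> d $ i" for i
    using v by (auto simp: extreme_point_of_def polyhedron_of_def less_eq_vec_def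
        matrix_vector_mul_component)
  have "eventually (\<lambda>\<epsilon>. M $ i \<bullet> (v + \<epsilon> *\<^sub>R w) \<le> d $ i \<and> M $ i \<bullet> (v - \<epsilon> *\<^sub>R w) \<le> d $ i) (at_right 0)"
    for i
  proof (cases "i \<in> J")
    case True
    then have "w \<bullet> M $ i = 0" by (intro w(2) span_base) auto
    then show ?thesis
      using vP[of i] by (simp add: inner_add_right inner_diff_right inner_commute)
  next
    case False
    then have lt: "M $ i \<bullet> v < d $ i" using vP[of i] unfolding J_def by auto
    have "((\<lambda>\<epsilon>. M $ i \<bullet> (v + \<epsilon> *\<^sub>R w)) \<longlongrightarrow> M $ i \<bullet> (v + 0 *\<^sub>R w)) (at_right 0)"
      "((\<lambda>\<epsilon>. M $ i \<bullet> (v - \<epsilon> *\<^sub>R w)) \<longlongrightarrow> M $ i \<bullet> (v - 0 *\<^sub>R w)) (at_right 0)"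
      by (intro tendsto_intros)+
    then have "eventually (\<lambda>\<epsilon>. M $ i \<bullet> (v + \<epsilon> *\<^sub>R w) < d $ i) (at_right 0)"
      "eventually (\<lambda>\<epsilon>. M $ i \<bullet> (v - \<epsilon> *\<^sub>R w) < d $ i) (at_right 0)"
      using lt by (auto intro: order_tendstoD(2))
    then show ?thesis by eventually_elim auto
  qed
  then have "eventually (\<lambda>\<epsilon>. \<forall>i. M $ i \<bullet> (v + \<epsilon> *\<^sub>R w) \<le> d $ i \<and> M $ i \<bullet> (v - \<epsilon> *\<^sub>R w) \<le> d $ i)
      (at_right 0)"
    by (rule eventually_all_finite)
  then have "eventually (\<lambda>\<epsilon>. (\<forall>i. M $ i \<bullet> (v + \<epsilon> *\<^sub>R w) \<le> d $ i \<and> M $ i \<bullet> (v - \<epsilon> *\<^sub>R w) \<le> d $ i)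
      \<and> \<epsilon> > 0) (at_right (0::real))"
    by (intro eventually_conj eventually_at_right_less)
  then obtain \<epsilon> :: real where \<epsilon>: "\<epsilon> > 0"
      "\<forall>i. M $ i \<bullet> (v + \<epsilon> *\<^sub>R w) \<le> d $ i \<and> M $ i \<bullet> (v - \<epsilon> *\<^sub>R w) \<le> d $ i"
    using eventually_happens'[OF trivial_limit_at_right_real] by blast
  define y z where "y = v + \<epsilon> *\<^sub>R w" and "z = v - \<epsilon> *\<^sub>R w"
  have "y \<in> polyhedron_of M d" "z \<in> polyhedron_of M d"
    using \<epsilon> by (auto simp: y_def z_def polyhedron_of_def less_eq_vec_def matrix_vector_mul_component)
  moreover have "v \<in> open_segment y z"
  proof -
    have "y - z = (2 * \<epsilon>) *\<^sub>R w" by (simp add: y_def z_def vec_eq_iff)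
    then have "y \<noteq> z" using w(1) \<epsilon>(1) by auto
    moreover have "v = (1 - 1/2) *\<^sub>R y + (1/2) *\<^sub>R z"
      by (simp add: y_def z_def vec_eq_iff field_simps)
    ultimately show ?thesis 
      unfolding in_segment by (intro conjI exI[of _ "1/2"]) simp_all
  qed
  ultimately show False using v by (auto simp: extreme_point_of_def)
qed

text \<open>Injectivity makes the Gram matrix \<open>transpose M ** M\<close> invertible. With
  \<open>R\<close> its inverse, \<open>R ** transpose M\<close> satisfies the four Penrose
  equations; this witness also settles existence, on which the \<open>THE\<close> in
  \<open>pseudoinverse\<close> depends.\<close>

lemma pseudoinverse_left_inverse:
  fixes M :: "real^'m^'c"
  assumes inj: "\<And>y. M *v y = 0 \<Longrightarrow> y = 0"
  shows "pseudoinverse M ** M = mat 1"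
proof -
  define S where "S = transpose M ** M"
  have "S *v y = 0 \<Longrightarrow> y = 0" for y
  proof -
    assume "S *v y = 0"
    then have "y \<bullet> (transpose M *v (M *v y)) = 0"
      by (simp add: S_def matrix_vector_mul_assoc)
    then have "(M *v y) \<bullet> (M *v y) = 0"
      by (metis dot_lmul_matrix inner_commute transpose_matrix_vector)
    then show "y = 0" using inj by simp
  qed
  then obtain R where RS: "R ** S = mat 1" using matrix_left_invertible_ker by blast
  have SR: "S ** R = mat 1" using RS matrix_left_right_inverse by blast
  have tS: "transpose S = S" by (simp add: S_def matrix_transpose_mul)
  \<comment> \<open>Both \<open>R\<close> and its transpose invert the symmetric matrix
    \<open>S\<close>, so they agree. This symmetry gives the third Penrose equation.\<close>
  have "transpose R ** S = mat 1" using SR tS by (metis matrix_transpose_mul transpose_mat)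
  then have tR: "transpose R = R" by (metis SR matrix_mul_assoc matrix_mul_lid matrix_mul_rid)
  define X where "X = R ** transpose M"
  have XM: "X ** M = mat 1" using RS by (simp add: X_def S_def matrix_mul_assoc)
  have "is_pseudoinverse M X"
    unfolding is_pseudoinverse_def
  proof (intro conjI)
    show "M ** X ** M = M" by (simp add: XM flip: matrix_mul_assoc)
    show "X ** M ** X = X" by (simp add: XM)
    show "transpose (M ** X) = M ** X"
      by (simp add: X_def matrix_transpose_mul tR matrix_mul_assoc)
    show "transpose (X ** M) = X ** M" by (simp add: XM)
  qed
  then show ?thesis using XM by (simp add: pseudoinverse_eqI)
qed

text \<open>For independent active rows \<open>J\<close>, as many as the dimension, the selected matrix has a left
  inverse. The null-space term vanishes and the starting point cancels, which leaves the vertex.\<close>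

lemma extreme_point_affine_proj:
  fixes M :: "real^'m^'c"
  assumes v: "v extreme_point_of polyhedron_of M d"
  obtains J where "J \<in> index_sets TYPE('m)" "affine_proj M d y0 w J = v"
proof -
  let ?row = "\<lambda>i. M $ i"
  have sp: "span (?row ` {i. M $ i \<bullet> v = d $ i}) = UNIV"
    using extreme_point_active_rows_span[OF v] .
  obtain B where B: "B \<subseteq> ?row ` {i. M $ i \<bullet> v = d $ i}" "independent B"
      "?row ` {i. M $ i \<bullet> v = d $ i} \<subseteq> span B"
      "card B = dim (?row ` {i. M $ i \<bullet> v = d $ i})"
    using basis_exists by blast
  have spB: "span B = UNIV" using span_minimal[OF B(3) subspace_span] sp by blast
  have "card B = CARD('m)"
    using B(4) dim_span[of "?row ` {i. M $ i \<bullet> v = d $ i}"] unfolding sp by simp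
  \<comment> \<open>Several indices may carry the same row; choosing one index per row of the basis
    gives \<open>J\<close> the cardinality of \<open>B\<close>.\<close>
  obtain J where J: "J \<subseteq> {i. M $ i \<bullet> v = d $ i}" "inj_on ?row J" "B = ?row ` J"
    using B(1) unfolding subset_image_inj by blast
  have cJ: "card J = CARD('m)" using J \<open>card B = CARD('m)\<close> by (simp add: card_image)
  \<comment> \<open>Hence there are at least \<open>CARD('m)\<close> rows, and the size of
    \<open>J\<close> is the minimum in \<open>index_sets\<close>.\<close>
  have "card J \<le> CARD('c)" by (simp add: card_mono)
  then have JI: "J \<in> index_sets TYPE('m)" using cJ by (simp add: index_sets_def)
  define MJ where "MJ = select_rows J M"
  have comp: "(MJ *v y) $ i = (if i \<in> J then M $ i \<bullet> y else 0)" for y i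
    by (simp add: MJ_def select_rows_def matrix_vector_mul_component)
  have "y = 0" if "MJ *v y = 0" for y
  proof -
    have "M $ i \<bullet> y = 0" if "i \<in> J" for i
      using comp[of y i] that \<open>MJ *v y = 0\<close> by simp
    then have "orthogonal y z" if "z \<in> B" for z
      using that J(3) by (auto simp: orthogonal_def inner_commute)
    then have "orthogonal y z" if "z \<in> span B" for z
      using orthogonal_to_span that by blast
    then show "y = 0" using spB by (metis UNIV_I orthogonal_self)
  qed
  then have inv: "pseudoinverse MJ ** MJ = mat 1" by (rule pseudoinverse_left_inverse)
  \<comment> \<open>The constraints in \<open>J\<close> are active at \<open>v\<close>, so the
    selected right-hand side is the image of \<open>v\<close>.\<close>
  have act: "select_rows J d = MJ *v v"
    using J(1) comp by (auto simp: vec_eq_iff select_rows_def)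
  have "affine_proj M d y0 w J = y0 - pseudoinverse MJ *v (MJ *v (y0 - v))"
    unfolding affine_proj_def Let_def MJ_def[symmetric]
    by (simp add: inv act matrix_vector_mult_diff_distrib)
  also have "\<dots> = v" by (simp add: matrix_vector_mul_assoc inv)
  finally show thesis using that JI by blast
qed

text \<open>A nonempty compact polyhedron has a vertex, and every vertex is a candidate whatever
  \<open>y0\<close> and \<open>w\<close> are. The candidates are finitely many, so a closest one
  exists.\<close>

lemma caffnet_lite_output_exists:
  fixes M :: "real^'m^'c"
  assumes "bounded (polyhedron_of M d)" "polyhedron_of M d \<noteq> {}"
  shows "\<exists>y. caffnet_lite_output p M d y0 w y"
proof -
  have "compact (polyhedron_of M d)"
    using assms(1) closed_polyhedron_of compact_eq_bounded_closed by blast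
  then obtain v where v: "v extreme_point_of polyhedron_of M d"
    using extreme_point_exists_convex convex_polyhedron_of assms(2) by metis
  then obtain J where "J \<in> index_sets TYPE('m)" "affine_proj M d y0 w J = v"
    using extreme_point_affine_proj by metis
  moreover have "M *v v \<le> d" using v by (auto simp: extreme_point_of_def polyhedron_of_def)
  ultimately have "candidates M d y0 w \<noteq> {}" unfolding candidates_def by blast
  moreover have "finite (candidates M d y0 w)"
    by (rule finite_subset[of _ "affine_proj M d y0 w ` UNIV"]) (auto simp: candidates_def)
  ultimately show ?thesis
    unfolding caffnet_lite_output_def
    using ex_is_arg_min_if_finite[of "candidates M d y0 w" "\<lambda>z. pnorm p (z - y0)"] by auto
qed

text \<open>Both branches of the output carry the constraints, however ties are broken. Safety of
  the closed loop rests on this fact.\<close>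

lemma caffnet_lite_output_feasible:
  assumes "caffnet_lite_output p M d y0 w y"
  shows "y \<in> polyhedron_of M d"
  using assms unfolding caffnet_lite_output_def
  by (auto simp: is_arg_min_def candidates_def polyhedron_of_def split: if_splits)

lemma stack_polyhedron_of:
  "polyhedron_of (stack_mat r M) (stack_vec s d) = {u \<in> polyhedron_of M d. r \<bullet> u \<le> s}"
  by (auto simp: polyhedron_of_def less_eq_vec_def matrix_vector_mul_component stack_mat_def
      stack_vec_def split: option.splits)

section \<open>Invariance\<close>

text \<open>A closed half-space is closed and convex, so it contains the closed convex hull taken
  with the empty null set.\<close>

lemma filippov_halfspace:
  assumes "\<delta> > 0" "\<And>y. y \<in> ball x \<delta> \<Longrightarrow> c \<le> a \<bullet> X y" "v \<in> filippov X x"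
  shows "c \<le> a \<bullet> v"
proof -
  have "v \<in> closure (convex hull (X ` (ball x \<delta> - {})))"
    using assms(1,3) unfolding filippov_def by blast
  also have "\<dots> \<subseteq> {z. c \<le> a \<bullet> z}"
    using assms(2) by (intro closure_minimal hull_minimal)
      (auto simp: convex_halfspace_ge closed_halfspace_ge)
  finally show ?thesis by simp
qed

text \<open>The covector \<open>k y\<close> varies with \<open>y\<close>, so it is frozen at
  \<open>k x\<close> to obtain a single half-space. This costs at most
  \<open>norm (k x - k y) * B\<close>, which vanishes as \<open>y\<close> tends to
  \<open>x\<close>.\<close>

lemma filippov_inner_ge:
  fixes X :: "'a::euclidean_space \<Rightarrow> 'a"
  assumes "isCont k x" "isCont \<rho> x" "\<And>y. \<rho> y \<le> k y \<bullet> X y"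
    and "\<delta> > 0" "\<And>y. y \<in> ball x \<delta> \<Longrightarrow> norm (X y) \<le> B"
    and v: "v \<in> filippov X x"
  shows "\<rho> x \<le> k x \<bullet> v"
proof (rule field_le_epsilon)
  fix e :: real assume "e > 0"
  have "B \<ge> 0" using assms(4) assms(5)[of x] norm_ge_zero[of "X x"] by (meson centre_in_ball order_trans)
  have "((\<lambda>y. \<rho> y - norm (k x - k y) * B) \<longlongrightarrow> \<rho> x - norm (k x - k x) * B) (at x)"
    using assms(1,2) by (intro tendsto_intros) (auto simp: isCont_def)
  then have "eventually (\<lambda>y. \<rho> x - e < \<rho> y - norm (k x - k y) * B) (at x)"
    using \<open>e > 0\<close> by (intro order_tendstoD(1)) auto
  then obtain \<eta> where \<eta>: "\<eta> > 0"
    "\<And>y. y \<noteq> x \<Longrightarrow> dist y x < \<eta> \<Longrightarrow> \<rho> x - e < \<rho> y - norm (k x - k y) * B"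
    unfolding eventually_at by blast
  have "\<rho> x - e \<le> k x \<bullet> v"
  proof (rule filippov_halfspace[OF _ _ v])
    show "min \<delta> \<eta> > 0" using \<eta>(1) assms(4) by simp
    fix y assume y: "y \<in> ball x (min \<delta> \<eta>)"
    have "\<rho> x - e \<le> \<rho> y - norm (k x - k y) * B"
      using \<eta>(2)[of y] y \<open>e > 0\<close> by (cases "y = x") (auto simp: dist_commute)
    also have "\<dots> \<le> k y \<bullet> X y - norm (k x - k y) * norm (X y)"
      using assms(3)[of y] assms(5)[of y] y by (intro diff_mono mult_left_mono) auto
    also have "\<dots> \<le> k y \<bullet> X y + (k x - k y) \<bullet> X y"
      using Cauchy_Schwarz_ineq2[of "k x - k y" "X y"] by linarith
    also have "\<dots> = k x \<bullet> X y" by (simp add: inner_diff_left)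
    finally show "\<rho> x - e \<le> k x \<bullet> X y" .
  qed
  then show "\<rho> x \<le> k x \<bullet> v + e" by simp
qed

section \<open>Gradients of continuously differentiable functions\<close>

lemma has_derivative_grad:
  assumes "(h has_derivative h') (at x)"
  shows "h' = (\<lambda>v. grad h x \<bullet> v)"
proof
  fix v
  have "frechet_derivative h (at x) = h'"
    using frechet_derivative_at[OF assms] by simp
  moreover have "linear h'" using assms has_derivative_linear by blast
  then have "h' (\<Sum>i\<in>UNIV. v $ i *s axis i 1) = (\<Sum>i\<in>UNIV. v $ i * h' (axis i 1))"
    by (simp add: linear_sum linear_cmul scalar_mult_eq_scaleR)
  ultimately show "h' v = grad h x \<bullet> v"
    by (simp add: basis_expansion grad_def inner_vec_def mult.commute)
qed

lemma continuously_differentiable_grad: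
  assumes "continuously_differentiable h"
  shows "\<And>x. (h has_derivative (\<lambda>v. grad h x \<bullet> v)) (at x)" "continuous_on UNIV (grad h)"
proof -
  obtain h' where h': "\<And>x. (h has_derivative blinfun_apply (h' x)) (at x)" "continuous_on UNIV h'"
    using assms unfolding continuously_differentiable_def by blast
  have eq: "blinfun_apply (h' x) = (\<lambda>v. grad h x \<bullet> v)" for x
    using has_derivative_grad[OF h'(1)] .
  show "(h has_derivative (\<lambda>v. grad h x \<bullet> v)) (at x)" for x using h'(1) by (simp add: eq)
  have "grad h = (\<lambda>x. \<chi> i. blinfun_apply (h' x) (axis i 1))"
    by (simp add: eq fun_eq_iff vec_eq_iff inner_axis)
  moreover have "continuous_on UNIV (\<lambda>x. \<chi> i. blinfun_apply (h' x) (axis i 1))"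
    using h'(2) by (intro continuous_intros)
  ultimately show "continuous_on UNIV (grad h)" by simp
qed

text \<open>The gradient is bounded on the compact convex ball. The Lipschitz bound serves to make
  \<open>h\<close> absolutely continuous along a trajectory.\<close>

lemma continuously_differentiable_lipschitz_on_cball:
  fixes h :: "real^'n \<Rightarrow> real"
  assumes "continuously_differentiable h"
  obtains K where "K-lipschitz_on (cball c R) h"
proof -
  note h = continuously_differentiable_grad[OF assms]
  have "compact (grad h ` cball c R)"
    using continuous_on_subset[OF h(2)] by (intro compact_continuous_image) auto
  then obtain K where K: "K > 0" "\<And>x. x \<in> cball c R \<Longrightarrow> norm (grad h x) \<le> K"
    by (metis compact_imp_bounded bounded_pos imageI)
  have "K-lipschitz_on (cball c R) h"
  proof (rule bounded_derivative_imp_lipschitz)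
    show "(h has_derivative (\<lambda>v. grad h x \<bullet> v)) (at x within cball c R)" for x
      using h(1) has_derivative_at_withinI by blast
    show "onorm (\<lambda>v. grad h x \<bullet> v) \<le> K" if "x \<in> cball c R" for x
    proof (rule onorm_le)
      fix v
      have "norm (grad h x \<bullet> v) \<le> norm (grad h x) * norm v" by (simp add: Cauchy_Schwarz_ineq2)
      also have "\<dots> \<le> K * norm v" using K(2)[OF that] by (intro mult_right_mono) auto
      finally show "norm (grad h x \<bullet> v) \<le> K * norm v" .
    qed
  qed (use K in auto)
  then show thesis by (rule that)
qed

section \<open>A scalar differential inequality along Filippov solutions\<close>

text \<open>After the last time \<open>t\<^sub>0\<close> in the safe set, \<open>\<psi> = h \<circ> x\<close> is negative and satisfies
  \<open>\<psi>' \<ge> L \<psi>\<close> almost everywhere near \<open>t\<^sub>0\<close>. On an interval of length at most \<open>1 / (2 L)\<close> its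
  minimum \<open>m\<close> would then satisfy \<open>m \<ge> m / 2\<close>.\<close>

lemma strongly_forward_invariantI:
  fixes h :: "real^'n \<Rightarrow> real"
  assumes h: "continuously_differentiable h"
    and \<alpha>: "local_lipschitz UNIV UNIV \<alpha>" "\<And>x. \<alpha> x 0 = 0"
    and X: "\<And>x v. v \<in> filippov X x \<Longrightarrow> - \<alpha> x (h x) \<le> grad h x \<bullet> v"
  shows "strongly_forward_invariant X (safe_set h)"
  unfolding strongly_forward_invariant_def
proof (intro allI impI ballI, elim conjE)
  fix I x t1
  assume sol: "filippov_solution X I x" and I: "0 \<in> I" "t1 \<in> I" "0 \<le> t1" and x0: "x 0 \<in> safe_set h"
  have sub: "{0..t1} \<subseteq> I"
    using sol I unfolding filippov_solution_def by (meson atLeastAtMost_iff mem_is_interval_1_I subsetI)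
  then have acx: "absolutely_continuous_on {0..t1} x"
    using sol unfolding filippov_solution_def by blast
  then have contx: "continuous_on {0..t1} x" by (rule absolutely_continuous_on_imp_continuous_on)
  note hd = continuously_differentiable_grad[OF h]
  define \<psi> where "\<psi> = (\<lambda>t. h (x t))"
  have "compact (x ` {0..t1})" using contx by (intro compact_continuous_image) auto
  then obtain R where "\<forall>y\<in>x ` {0..t1}. norm y \<le> R"
    using compact_imp_bounded bounded_iff by blast
  then have "x ` {0..t1} \<subseteq> cball 0 R" by auto
  then obtain K where "K-lipschitz_on (x ` {0..t1}) h"
    using continuously_differentiable_lipschitz_on_cball[OF h] lipschitz_on_subset by metis
  then have ac\<psi>: "absolutely_continuous_on {0..t1} \<psi>"
    unfolding \<psi>_def using absolutely_continuous_on_lipschitz_compose[OF acx] by blast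
  then have cont\<psi>: "continuous_on {0..t1} \<psi>" by (rule absolutely_continuous_on_imp_continuous_on)
  have der: "AE t in lebesgue. t \<in> {0..t1} \<longrightarrow>
      (\<exists>v\<ge>- \<alpha> (x t) (\<psi> t). (\<psi> has_vector_derivative v) (at t within {0..t1}))"
  proof -
    have "\<exists>v\<ge>- \<alpha> (x t) (\<psi> t). (\<psi> has_vector_derivative v) (at t within {0..t1})"
      if "v \<in> filippov X (x t)" "(x has_vector_derivative v) (at t within I)" for t v
    proof -
      have "(x has_vector_derivative v) (at t within {0..t1})"
        using that(2) sub has_vector_derivative_within_subset by blast
      then have "(\<psi> has_vector_derivative grad h (x t) \<bullet> v) (at t within {0..t1})"
        unfolding \<psi>_def has_vector_derivative_def
        using has_derivative_compose[OF _ hd(1)] by fastforce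
      then show ?thesis using X[OF that(1)] unfolding \<psi>_def by blast
    qed
    moreover have "AE t in lebesgue. t \<in> I \<longrightarrow>
        (\<exists>v\<in>filippov X (x t). (x has_vector_derivative v) (at t within I))"
      using sol unfolding filippov_solution_def by blast
    ultimately show ?thesis using sub by (auto elim!: eventually_mono)
  qed
  show "x t1 \<in> safe_set h"
  proof (rule ccontr)
    assume "x t1 \<notin> safe_set h"
    then have neg: "\<psi> t1 < 0" by (simp add: \<psi>_def safe_set_def)
    define S where "S = {t \<in> {0..t1}. 0 \<le> \<psi> t}"
    have "S = {0..t1} \<inter> \<psi> -` {0..}" by (auto simp: S_def)
    then have "closed S" using cont\<psi> by (simp add: continuous_closed_preimage)
    moreover have "bounded S" by (rule bounded_subset[of "{0..t1}"]) (auto simp: S_def)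
    ultimately have "compact S" by (simp add: compact_eq_bounded_closed)
    moreover have "0 \<in> S" using x0 I by (simp add: S_def \<psi>_def safe_set_def)
    ultimately obtain t0 where t0: "t0 \<in> S" "\<And>t. t \<in> S \<Longrightarrow> t \<le> t0"
      using compact_attains_sup[of S] by blast
    have t0b: "0 \<le> t0" "t0 \<le> t1" "0 \<le> \<psi> t0" using t0 by (auto simp: S_def)
    have "t0 \<noteq> t1" using neg t0b(3) by auto
    then have t01: "t0 < t1" using t0b by simp
    have neg': "\<psi> t < 0" if "t0 < t" "t \<le> t1" for t
      using t0(2)[of t] that t0b(1) by (force simp: S_def)
    \<comment> \<open>A zero of \<psi> exists between \<open>t0\<close> and \<open>t1\<close>; since
      \<psi> is negative after \<open>t0\<close>, it can only be \<open>t0\<close> itself.\<close>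
    have "continuous_on {t0..t1} \<psi>" using cont\<psi> t0b by (auto elim: continuous_on_subset)
    then obtain r where "t0 \<le> r" "r \<le> t1" "\<psi> r = 0"
      using IVT2'[of \<psi> t1 0 t0] neg t0b by auto
    then have \<psi>0: "\<psi> t0 = 0" using neg'[of r] by (cases "r = t0") auto
    \<comment> \<open>One constant \<open>L\<close> serves all states near \<open>x t0\<close>,
      although the trajectory moves.\<close>
    obtain u L where u: "u > 0" "\<And>s. s \<in> cball (x t0) u \<inter> UNIV \<Longrightarrow> L-lipschitz_on (cball 0 u \<inter> UNIV) (\<alpha> s)"
      using local_lipschitzE[OF \<alpha>(1), of "x t0" 0] by auto
    have L0: "L \<ge> 0" using u lipschitz_on_nonneg[of L] by (metis IntI UNIV_I centre_in_cball less_imp_le)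
    \<comment> \<open>The shift by one makes the constant positive, so that
      \<open>1 / (2 * L')\<close> is a valid length.\<close>
    define L' where "L' = L + 1"
    have \<alpha>le: "\<alpha> s z \<le> L' * \<bar>z\<bar>" if "s \<in> cball (x t0) u" "\<bar>z\<bar> \<le> u" for s z
    proof -
      have "dist (\<alpha> s z) (\<alpha> s 0) \<le> L * dist z 0"
        using u(1) that by (intro lipschitz_onD[OF u(2)]) (auto simp: dist_real_def)
      then have "\<alpha> s z \<le> L * \<bar>z\<bar>" by (simp add: \<alpha>(2) dist_real_def)
      also have "\<dots> \<le> L' * \<bar>z\<bar>" unfolding L'_def by (intro mult_right_mono) auto
      finally show ?thesis .
    qed
    obtain \<eta>1 where \<eta>1: "\<eta>1 > 0" "\<And>t. t \<in> {0..t1} \<Longrightarrow> dist t t0 < \<eta>1 \<Longrightarrow> dist (x t) (x t0) < u"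
      using contx t0b u(1) unfolding continuous_on_iff by (metis atLeastAtMost_iff)
    obtain \<eta>2 where \<eta>2: "\<eta>2 > 0" "\<And>t. t \<in> {0..t1} \<Longrightarrow> dist t t0 < \<eta>2 \<Longrightarrow> dist (\<psi> t) (\<psi> t0) < u"
      using cont\<psi> t0b u(1) unfolding continuous_on_iff by (metis atLeastAtMost_iff)
    \<comment> \<open>The halves turn the strict continuity radii into bounds that hold up to the
      endpoint \<open>t0 + \<eta>\<close>.\<close>
    define \<eta> where "\<eta> = Min {\<eta>1 / 2, \<eta>2 / 2, t1 - t0, 1 / (2 * L')}"
    have L': "L' > 0" using L0 by (simp add: L'_def)
    have \<eta>: "\<eta> > 0" "\<eta> < \<eta>1" "\<eta> < \<eta>2" "\<eta> \<le> t1 - t0" "\<eta> \<le> 1 / (2 * L')"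
      using \<eta>1(1) \<eta>2(1) t01 L' by (auto simp: \<eta>_def min_def)
    have "L' * \<eta> \<le> L' * (1 / (2 * L'))" using \<eta>(5) L' by (intro mult_left_mono) auto
    then have half: "L' * \<eta> \<le> 1 / 2" using L' by simp
    define s where "s = t0 + \<eta>"
    have s: "t0 < s" "s \<le> t1" using \<eta> by (auto simp: s_def)
    have "continuous_on {t0..s} \<psi>" using cont\<psi> t0b s by (auto elim: continuous_on_subset)
    then obtain tm where tm: "tm \<in> {t0..s}" "\<And>t. t \<in> {t0..s} \<Longrightarrow> \<psi> tm \<le> \<psi> t"
      using continuous_attains_inf[of "{t0..s}" \<psi>] s by auto
    have m: "\<psi> tm < 0" using tm(2)[of s] neg'[of s] s by auto
    have sub': "{t0..tm} \<subseteq> {0..t1}" using tm s t0b by auto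
    \<comment> \<open>Where \<psi> is nonpositive, \<open>- L' * \<bar>\<psi> t\<bar>\<close> equals
      \<open>L' * \<psi> t\<close>, which is at least \<open>L' * \<psi> tm\<close>. This constant
      bounds the derivative from below up to the minimizer.\<close>
    have "L' * \<psi> tm * (tm - t0) \<le> \<psi> tm - \<psi> t0"
    proof (rule absolutely_continuous_on_derivative_ge)
      show "absolutely_continuous_on {t0..tm} \<psi>"
        using absolutely_continuous_on_subset[OF ac\<psi> sub'] .
      have low: "L' * \<psi> tm \<le> - \<alpha> (x t) (\<psi> t)" if "t \<in> {t0..tm}" for t
      proof -
        have t: "t \<in> {t0..s}" "t \<in> {0..t1}" using that tm sub' by auto
        have "dist t t0 < \<eta>1" "dist t t0 < \<eta>2"
          using t \<eta> by (auto simp: s_def dist_real_def)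
        then have "x t \<in> cball (x t0) u" "\<bar>\<psi> t\<bar> \<le> u"
          using \<eta>1(2)[of t] \<eta>2(2)[of t] t \<psi>0 by (auto simp: dist_commute dist_real_def)
        then have "\<alpha> (x t) (\<psi> t) \<le> L' * \<bar>\<psi> t\<bar>" by (rule \<alpha>le)
        moreover have "\<psi> t \<le> 0" using neg'[of t] t \<psi>0 s by (cases "t = t0") auto
        moreover have "L' * \<psi> tm \<le> L' * \<psi> t" using tm(2) t L' by (intro mult_left_mono) auto
        ultimately show ?thesis by simp
      qed
      show "AE t in lebesgue. t \<in> {t0..tm} \<longrightarrow>
          (\<exists>v\<ge>L' * \<psi> tm. (\<psi> has_vector_derivative v) (at t within {t0..tm}))"
        using der
      proof eventually_elim
        case (elim t)
        show ?case
        proof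
          assume t: "t \<in> {t0..tm}"
          then obtain v where "v \<ge> - \<alpha> (x t) (\<psi> t)" "(\<psi> has_vector_derivative v) (at t within {0..t1})"
            using elim sub' by blast
          then show "\<exists>v\<ge>L' * \<psi> tm. (\<psi> has_vector_derivative v) (at t within {t0..tm})"
            using low[OF t] has_vector_derivative_within_subset[OF _ sub'] by (meson order_trans)
        qed
      qed
    qed (use tm in auto)
    moreover have "L' * (tm - t0) \<le> L' * \<eta>"
      using tm L' by (intro mult_left_mono) (auto simp: s_def)
    then have "L' * (tm - t0) \<le> 1 / 2" using half by linarith
    \<comment> \<open>Multiplication by the negative minimum reverses the inequality; with
      \<open>\<psi> t0 = 0\<close> the minimum is at least half of itself, which is
      impossible.\<close>
    then have "1 / 2 * \<psi> tm \<le> L' * (tm - t0) * \<psi> tm"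
      using m by (intro mult_right_mono_neg) auto
    moreover have "L' * \<psi> tm * (tm - t0) = L' * (tm - t0) * \<psi> tm" by simp
    ultimately show False using m \<psi>0 by linarith
  qed
qed

section \<open>Local bounds and the closed loop\<close>

lemma locally_lipschitz_imp_continuous_on:
  assumes "locally_lipschitz k"
  shows "continuous_on UNIV k"
proof -
  have "isCont k x" for x
  proof -
    obtain u L where "u > 0" "L-lipschitz_on (cball x u) k"
      using assms unfolding locally_lipschitz_def by blast
    then have "continuous_on (ball x u) k"
      using continuous_on_subset[OF lipschitz_on_continuous_on ball_subset_cball] by simp
    then show ?thesis using \<open>u > 0\<close> by (simp add: continuous_on_eq_continuous_at)
  qed
  then show ?thesis by (simp add: continuous_at_imp_continuous_on)
qed

text \<open>The control is treated as an independent variable in the compact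
  \<open>closure U\<close>. The bound is thus uniform over all inputs and applies to a discontinuous
  feedback.\<close>

lemma control_affine_locally_bounded:
  fixes f :: "real^'n \<Rightarrow> real^'n" and g :: "real^'n \<Rightarrow> real^'m^'n"
  assumes "continuous_on UNIV f" "continuous_on UNIV g" "bounded U"
  obtains B where "\<And>y u. y \<in> cball x r \<Longrightarrow> u \<in> U \<Longrightarrow> norm (f y + g y *v u) \<le> B"
proof -
  have *: "continuous_on T (\<lambda>z. f (fst z))" "continuous_on T (\<lambda>z. g (fst z))"
    for T :: "((real^'n) \<times> (real^'m)) set"
    by (rule continuous_on_compose2[OF assms(1)] continuous_on_compose2[OF assms(2)];
        auto intro: continuous_intros)+
  have "continuous_on (cball x r \<times> closure U) (\<lambda>z. f (fst z) + g (fst z) *v snd z)"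
    unfolding matrix_vector_mult_def by (intro continuous_intros *)
  then have "compact ((\<lambda>z. f (fst z) + g (fst z) *v snd z) ` (cball x r \<times> closure U))"
    using assms(3) by (intro compact_continuous_image compact_Times) auto
  then obtain B where "\<forall>z\<in>(\<lambda>z. f (fst z) + g (fst z) *v snd z) ` (cball x r \<times> closure U). norm z \<le> B"
    by (meson compact_imp_bounded bounded_iff)
  then have "norm (f y + g y *v u) \<le> B" if "y \<in> cball x r" "u \<in> U" for y u
    using that closure_subset by fastforce
  then show thesis by (rule that)
qed

text \<open>The controller is a relation, so the existence clause ensures that the statement about
  every \<pi> is not vacuous.\<close>

theorem theorem1:
  fixes f :: "real^'n \<Rightarrow> real^'n"
    and g :: "real^'n \<Rightarrow> real^'m^'n"
    and P :: "real^'m^'p" and q :: "real^'p"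
    and h :: "real^'n \<Rightarrow> real"
    and \<alpha> :: "real^'n \<Rightarrow> real \<Rightarrow> real"
    and f\<^sub>\<theta> w\<^sub>\<phi> :: "real^'n \<Rightarrow> real^'m"
    and p :: ereal
  defines "U \<equiv> polyhedron_of P q"
    and "A \<equiv> constraint_mat g h P"
    and "b \<equiv> constraint_vec f h \<alpha> q"
  assumes "locally_lipschitz f" and "locally_lipschitz g"
    and "bounded U"
    and "control_barrier_function f g U h"
    and "continuous_on UNIV A" and "continuous_on UNIV b"
    and "regular_value h 0"
    and "local_lipschitz UNIV UNIV \<alpha>" and "\<forall>x. \<alpha> x 0 = 0"
    and "\<forall>x. polyhedron_of (A x) (b x) \<noteq> {}"
    and "1 \<le> p"
  shows "(\<exists>\<pi>. caffnet_lite_controller p A b f\<^sub>\<theta> w\<^sub>\<phi> \<pi>) \<and>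
    (\<forall>\<pi>. caffnet_lite_controller p A b f\<^sub>\<theta> w\<^sub>\<phi> \<pi> \<longrightarrow>
       (\<forall>x. \<pi> x \<in> U) \<and>
       strongly_forward_invariant (\<lambda>x. f x + g x *v \<pi> x) (safe_set h))"
proof (intro conjI allI impI)
  have K: "polyhedron_of (A x) (b x) = {u \<in> U. - lie_g g h x \<bullet> u \<le> lie_f f h x + \<alpha> x (h x)}" for x
    unfolding A_def b_def constraint_mat_def constraint_vec_def stack_polyhedron_of U_def ..
  have "\<exists>y. caffnet_lite_output p (A x) (b x) (f\<^sub>\<theta> x) (w\<^sub>\<phi> x) y" for x
  proof (rule caffnet_lite_output_exists)
    show "bounded (polyhedron_of (A x) (b x))"
      using \<open>bounded U\<close> by (rule bounded_subset) (auto simp: K)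
  qed (use \<open>\<forall>x. polyhedron_of (A x) (b x) \<noteq> {}\<close> in blast)
  then show "\<exists>\<pi>. caffnet_lite_controller p A b f\<^sub>\<theta> w\<^sub>\<phi> \<pi>"
    unfolding caffnet_lite_controller_def by metis
  fix \<pi> assume "caffnet_lite_controller p A b f\<^sub>\<theta> w\<^sub>\<phi> \<pi>"
  then have feas: "\<pi> x \<in> polyhedron_of (A x) (b x)" for x
    using caffnet_lite_output_feasible unfolding caffnet_lite_controller_def by blast
  then show \<pi>U: "\<pi> x \<in> U" for x using K by blast
  define X where "X = (\<lambda>x. f x + g x *v \<pi> x)"
  define \<rho> where "\<rho> = (\<lambda>x. - \<alpha> x (h x))"
  have cd: "continuously_differentiable h"
    using \<open>control_barrier_function f g U h\<close> unfolding control_barrier_function_def by blast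
  note grad_cont = continuously_differentiable_grad(2)[OF cd]
  have f_cont: "continuous_on UNIV f" and g_cont: "continuous_on UNIV g"
    using \<open>locally_lipschitz f\<close> \<open>locally_lipschitz g\<close> locally_lipschitz_imp_continuous_on by blast+
  \<comment> \<open>Continuity of \<alpha> in the state is not assumed directly; continuity of
    \<rho> is read off the \<open>None\<close> component of the continuous vector
    \<open>b\<close>.\<close>
  have "\<rho> = (\<lambda>x. grad h x \<bullet> f x - b x $ None)"
    by (simp add: \<rho>_def b_def constraint_vec_def stack_vec_def lie_f_def fun_eq_iff)
  moreover have "continuous_on UNIV (\<lambda>x. grad h x \<bullet> f x - b x $ None)"
    using \<open>continuous_on UNIV b\<close> grad_cont f_cont by (intro continuous_intros)
  ultimately have \<rho>_cont: "continuous_on UNIV \<rho>" by simp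
  \<comment> \<open>This is the \<open>None\<close> row of the feasibility condition, with the Lie
    derivatives combined into the gradient along \<open>X\<close>.\<close>
  have X_ge: "\<rho> y \<le> grad h y \<bullet> X y" for y
    using feas[of y] unfolding K \<rho>_def X_def
    by (simp add: lie_f_def lie_g_def dot_lmul_matrix inner_add_right)
  have "- \<alpha> x (h x) \<le> grad h x \<bullet> v" if "v \<in> filippov X x" for x v
  proof -
    obtain B where "\<And>y u. y \<in> cball x 1 \<Longrightarrow> u \<in> U \<Longrightarrow> norm (f y + g y *v u) \<le> B"
      using control_affine_locally_bounded[OF f_cont g_cont \<open>bounded U\<close>] by blast
    then have bd: "norm (X y) \<le> B" if "y \<in> ball x 1" for y
      using \<pi>U that unfolding X_def by auto
    have cont: "isCont (grad h) x" "isCont \<rho> x"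
      using grad_cont \<rho>_cont by (auto simp: continuous_on_eq_continuous_at)
    have "\<rho> x \<le> grad h x \<bullet> v"
      using filippov_inner_ge[OF cont X_ge zero_less_one bd that] .
    then show ?thesis by (simp add: \<rho>_def)
  qed
  then have "strongly_forward_invariant X (safe_set h)"
    using strongly_forward_invariantI[OF cd \<open>local_lipschitz UNIV UNIV \<alpha>\<close>] \<open>\<forall>x. \<alpha> x 0 = 0\<close>
    by simp
  then show "strongly_forward_invariant (\<lambda>x. f x + g x *v \<pi> x) (safe_set h)"
    unfolding X_def .
qed

end
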